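(* Let $v_1, \dots, v_N \in \mathbb{C}^r$ form a unit norm tight frame, let $X \in \mathbb{C}^{N \times N}$ be its Gram matrix, $X_{ij} = \langle v_i, v_j \rangle$, and let $x_1, \dots, x_N$ be the columns of $X$. Suppose the matrices $v_i v_i^*$, $i = 1, \dots, N$, are linearly independent, or equivalently that $|X|^{\odot 2}$ is non-singular. Let $\mathcal{P}$ be the orthogonal projection (with respect to the Frobenius inner product) from $\mathbb{C}^{N \times N}_{\mathrm{herm}}$ onto $\mathrm{pert}_{\widetilde{\mathscr{E}}^N}(X)$. Then for every $A \in \mathbb{C}^{N \times N}_{\mathrm{herm}}$, $$\mathcal{P}A = \frac{r^2}{N^2}\Bigg(X A X - \sum_{i, j = 1}^N \big((|X|^{\odot 2})^{-1}\big)_{ij}\, (x_i^* A x_i)\, x_j x_j^*\Bigg).$$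
   Context: Inner products on $\mathbb{C}^r$ are $\langle u, w \rangle = u^* w$. Unit vectors $v_1, \dots, v_N \in \mathbb{C}^r$ form a unit norm tight frame (UNTF) if $\sum_{i=1}^N v_i v_i^* = \frac{N}{r} I_r$. For a matrix $M$, $|M|^{\odot 2}$ denotes the matrix of entrywise squared absolute values, $(|M|^{\odot 2})_{ij} = |M_{ij}|^2$. $\mathbb{C}^{N\times N}_{\mathrm{herm}}$ is the real vector space of $N \times N$ Hermitian matrices with the Frobenius inner product $\langle A, B \rangle_F = \mathrm{Tr}(AB)$ and norm $\|A\|_F = \langle A, A\rangle_F^{1/2}$. The complex elliptope is $$\widetilde{\mathscr{E}}^N = \{ X \in \mathbb{C}^{N \times N}_{\mathrm{herm}} : X \succeq 0,\ X_{ii} = 1 \text{ for all } i \}.$$ For a closed convex set $K$ in a finite-dimensional real vector space $W$ and $X \in K$, the perturbation of $X$ in $K$ is the linear subspace $$\mathrm{pert}_K(X) = \{ A \in W : \exists\, t > 0 \text{ with } X + tA \in K \text{ and } X - tA \in K \}.$$ Here $K = \widetilde{\mathscr{E}}^N$ and $W = \mathbb{C}^{N \times N}_{\mathrm{herm}}$. The orthogonal projection is $\mathcal{P}A = \arg\min_{B \in \mathrm{pert}_{\widetilde{\mathscr{E}}^N}(X)} \frac12 \|A - B\|_F^2$. *)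

theory Defs
  imports "HOL-Analysis.Analysis"
begin

(* Antilinear in the first argument: u^* w. *)
definition cinner :: "complex ^ 'm \<Rightarrow> complex ^ 'm \<Rightarrow> complex" where
  "cinner u w = (\<Sum>k\<in>UNIV. cnj (u $ k) * w $ k)"

(* u u^* *)
definition rank_one :: "complex ^ 'm \<Rightarrow> complex ^ 'm ^ 'm" where
  "rank_one u = (\<chi> k l. u $ k * cnj (u $ l))"

(* Scalar multiplication of a complex matrix by a complex number;
   the library provides only *\<^sub>R on the type complex ^ 'n ^ 'm. *)
definition scale_mat :: "complex \<Rightarrow> complex ^ 'n ^ 'm \<Rightarrow> complex ^ 'n ^ 'm" where
  "scale_mat c A = (\<chi> i j. c * A $ i $ j)"

definition conj_transpose :: "complex ^ 'n ^ 'm \<Rightarrow> complex ^ 'm ^ 'n" where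
  "conj_transpose A = (\<chi> i j. cnj (A $ j $ i))"

definition herm :: "(complex ^ 'n ^ 'n) set" where
  "herm = {A. conj_transpose A = A}"

(* For A, B in herm, Tr(AB) is real, so Re only changes the type. *)
definition frob_inner :: "complex ^ 'n ^ 'n \<Rightarrow> complex ^ 'n ^ 'n \<Rightarrow> real" where
  "frob_inner A B = Re (trace (A ** B))"

definition frob_norm :: "complex ^ 'n ^ 'n \<Rightarrow> real" where
  "frob_norm A = sqrt (frob_inner A A)"

(* For A in herm, z^* A z is real, so Re only changes the type. *)
definition psd :: "complex ^ 'n ^ 'n \<Rightarrow> bool" where
  "psd A \<longleftrightarrow> A \<in> herm \<and> (\<forall>z. 0 \<le> Re (cinner z (A *v z)))"

definition untf :: "('n::finite \<Rightarrow> complex ^ 'r) \<Rightarrow> bool" where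
  "untf v \<longleftrightarrow> (\<forall>i. norm (v i) = 1) \<and>
     (\<Sum>i\<in>UNIV. rank_one (v i)) = (real CARD('n) / real CARD('r)) *\<^sub>R mat 1"

definition gram :: "('n::finite \<Rightarrow> complex ^ 'r) \<Rightarrow> complex ^ 'n ^ 'n" where
  "gram v = (\<chi> i j. cinner (v i) (v j))"

definition abs_sq_mat :: "complex ^ 'n ^ 'm \<Rightarrow> real ^ 'n ^ 'm" where
  "abs_sq_mat M = (\<chi> i j. (cmod (M $ i $ j))\<^sup>2)"

(* Linear independence over the reals of an indexed family:
   injectivity excludes repeated members. *)
definition indep_family :: "('i \<Rightarrow> 'a::real_vector) \<Rightarrow> bool" where
  "indep_family f \<longleftrightarrow> inj f \<and> independent (range f)"

definition elliptope :: "(complex ^ 'n ^ 'n) set" where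
  "elliptope = {X \<in> herm. psd X \<and> (\<forall>i. X $ i $ i = 1)}"

(* The perturbation of X in K, where W is the ambient real vector space. *)
definition pert :: "'a::real_vector set \<Rightarrow> 'a set \<Rightarrow> 'a \<Rightarrow> 'a set" where
  "pert W K X = {A \<in> W. \<exists>t>0. X + t *\<^sub>R A \<in> K \<and> X - t *\<^sub>R A \<in> K}"

(* Intended for A in herm and S a real linear subspace of herm, where the
   minimizer exists and is unique. *)
definition frob_proj :: "(complex ^ 'n ^ 'n) set \<Rightarrow> complex ^ 'n ^ 'n \<Rightarrow> complex ^ 'n ^ 'n" where
  "frob_proj S A = arg_min_on (\<lambda>B. 1 / 2 * (frob_norm (A - B))\<^sup>2) S"

end

theory Submission
  imports Defs
begin

text \<open>
  Put \<open>c = N / r\<close>. The tight frame identity turns into \<open>X ** X = c *\<^sub>R X\<close> for the Gram matrix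
  \<open>X\<close>, so \<open>X / c\<close> is an orthogonal projection; the unit norms make the diagonal of \<open>X\<close> equal to 1.

  Let \<open>B\<close> be a perturbation of \<open>X\<close> in the elliptope. The diagonal of \<open>X\<close> cannot move, so that of
  \<open>B\<close> vanishes. On the kernel of \<open>X\<close> the quadratic forms of \<open>X \<plusminus> t B\<close> are those of \<open>\<plusminus> t B\<close>; both
  are nonnegative, hence zero, and by positive semidefiniteness \<open>B\<close> vanishes on that kernel.
  Equivalently, \<open>X ** B ** X = c\<^sup>2 *\<^sub>R B\<close>. Conversely, a Hermitian \<open>B\<close> with these two properties is
  dominated by a multiple of \<open>X\<close>, so it is a perturbation (\<open>pert_elliptope_eq\<close>).

  The perturbation space is therefore cut out of the space of Hermitian matrices by two linear
  conditions, and the formula has one correction for each: \<open>A \<mapsto> X ** A ** X / c\<^sup>2\<close> projects onto the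
  matrices with \<open>X ** B ** X = c\<^sup>2 *\<^sub>R B\<close>; inside this space the functional \<open>B \<mapsto> B\<^sub>j\<^sub>j\<close> is, up to
  a factor, the inner product with \<open>x\<^sub>j x\<^sub>j\<^sup>*\<close>, so it remains to subtract the combination of
  the \<open>x\<^sub>j x\<^sub>j\<^sup>*\<close> that makes the diagonal zero. Its coefficients solve a linear system whose matrix
  is \<open>|X|\<^sup>2\<close> taken entrywise (\<open>frob_proj_pert_elliptope\<close>).

  That system is nonsingular exactly when the \<open>v\<^sub>i v\<^sub>i\<^sup>*\<close> are linearly independent, because
  \<open>|\<langle>v\<^sub>i, v\<^sub>j\<rangle>|\<^sup>2\<close> is the inner product of \<open>v\<^sub>i v\<^sub>i\<^sup>*\<close> and \<open>v\<^sub>j v\<^sub>j\<^sup>*\<close>: the matrix is their Gram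
  matrix (\<open>indep_family_iff_invertible_gram\<close>).
\<close>

section \<open>Hermitian matrices and the Frobenius inner product\<close>

lemma matrix_vector_mult_scaleR_right: "A *v (c *\<^sub>R z) = c *\<^sub>R (A *v z)"
  for A :: "'a::real_algebra_1 ^ 'n::finite ^ 'm"
  by (simp add: matrix_vector_mult_def vec_eq_iff scaleR_sum_right)

lemma matrix_vector_mult_scaleR_left: "(c *\<^sub>R A) *v z = c *\<^sub>R (A *v z)"
  for A :: "'a::real_algebra_1 ^ 'n::finite ^ 'm"
  by (simp add: matrix_vector_mult_def vec_eq_iff scaleR_sum_right)

lemma linear_sandwich: "linear (\<lambda>Y. X ** Y ** X)"
  for X :: "complex ^ 'n::finite ^ 'n"
proof (rule linearI)
  show "X ** (Y + Z) ** X = X ** Y ** X + X ** Z ** X" for Y Z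
    by (simp add: vec_eq_iff matrix_matrix_mult_def sum.distrib algebra_simps)
  show "X ** (r *\<^sub>R Y) ** X = r *\<^sub>R (X ** Y ** X)" for r Y
    by (simp add: matrix_scalar_ac scalar_matrix_assoc)
qed

lemma norm_matrix_vector_mult_le:
  fixes B :: "complex ^ 'n::finite ^ 'm::finite"
  obtains K where "K > 0" "\<And>z. norm (B *v z) \<le> K * norm z"
proof -
  have "bounded_linear (\<lambda>z. B *v z)"
    using linear_conv_bounded_linear matrix_vector_mul_linear by blast
  then show thesis
    using bounded_linear.pos_bounded[of "\<lambda>z. B *v z"] that by (auto simp: mult.commute)
qed

text \<open>
  The real part of the complex inner product is the Euclidean inner product that the type carries
  as a real space, which gives access to Cauchy--Schwarz and Pythagoras.
\<close>

lemma Re_cinner: "Re (cinner u w) = u \<bullet> w"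
  for u w :: "complex ^ 'm::finite"
  by (simp add: cinner_def inner_vec_def inner_complex_def)

lemma hermD: "A \<in> herm \<Longrightarrow> conj_transpose A = A"
  by (simp add: herm_def)

lemma herm_component: "A \<in> herm \<Longrightarrow> cnj (A $ j $ i) = A $ i $ j"
  unfolding herm_def conj_transpose_def by (auto simp: vec_eq_iff)

lemma conj_transpose_mult:
  "conj_transpose (A ** B) = conj_transpose B ** conj_transpose A"
  for A :: "complex ^ 'm::finite ^ 'n::finite" and B :: "complex ^ 'p::finite ^ 'm"
  by (simp add: conj_transpose_def matrix_matrix_mult_def vec_eq_iff mult.commute)

lemma herm_sandwich: "X ** A ** X \<in> herm" if "X \<in> herm" "A \<in> herm"
  for X A :: "complex ^ 'n::finite ^ 'n"
  using that by (simp add: herm_def conj_transpose_mult matrix_mul_assoc)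

lemma herm_diff: "A - B \<in> herm" if "A \<in> herm" "B \<in> herm"
  using that by (simp add: herm_def conj_transpose_def vec_eq_iff)

lemma herm_add: "A + B \<in> herm" if "A \<in> herm" "B \<in> herm"
  using that by (simp add: herm_def conj_transpose_def vec_eq_iff)

lemma herm_scaleR: "c *\<^sub>R A \<in> herm" if "A \<in> herm"
  using that by (simp add: herm_def conj_transpose_def vec_eq_iff)

lemma herm_sum: "(\<Sum>i\<in>I. f i) \<in> herm" if "\<And>i. i \<in> I \<Longrightarrow> f i \<in> herm"
  using that
proof (induction I rule: infinite_finite_induct)
  case (insert x F)
  then show ?case by (simp add: herm_add)
qed (auto simp: herm_def conj_transpose_def vec_eq_iff)

lemma herm_rank_one: "rank_one u \<in> herm"
  by (simp add: herm_def conj_transpose_def vec_eq_iff rank_one_def mult.commute)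

lemma cinner_matrix_adjoint:
  "cinner u (A *v w) = cinner (conj_transpose A *v u) w"
  for A :: "complex ^ 'n::finite ^ 'm::finite"
proof -
  have "cinner u (A *v w) = (\<Sum>k\<in>UNIV. \<Sum>l\<in>UNIV. cnj (u $ k) * (A $ k $ l * w $ l))"
    by (simp add: cinner_def matrix_vector_mult_def sum_distrib_left)
  also have "\<dots> = (\<Sum>l\<in>UNIV. \<Sum>k\<in>UNIV. cnj (u $ k) * (A $ k $ l * w $ l))"
    by (rule sum.swap)
  finally show ?thesis
    by (simp add: cinner_def matrix_vector_mult_def conj_transpose_def sum_distrib_left
        sum_distrib_right mult_ac)
qed

lemma cnj_cinner: "cnj (cinner u w) = cinner w u"
  by (simp add: cinner_def mult.commute)

lemma cinner_herm_real:
  "cinner u (A *v u) = of_real (u \<bullet> (A *v u))" if "A \<in> herm"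
  for A :: "complex ^ 'n::finite ^ 'n"
proof -
  have "cnj (cinner u (A *v u)) = cinner u (A *v u)"
    using that by (simp add: cnj_cinner cinner_matrix_adjoint[of u A] hermD)
  then show ?thesis
    by (metis Re_cinner Reals_cases Reals_cnj_iff Re_complex_of_real)
qed

lemma inner_herm_adjoint: "u \<bullet> (A *v w) = (A *v u) \<bullet> w" if "A \<in> herm"
  for A :: "complex ^ 'n::finite ^ 'n"
  using cinner_matrix_adjoint[of u A w] that by (metis Re_cinner hermD)

text \<open>
  Since \<open>A\<close> is Hermitian, \<open>A\<^sub>i\<^sub>k\<close> is the conjugate of \<open>A\<^sub>k\<^sub>i\<close>, so the trace is the sum of the entrywise
  inner products. On Hermitian matrices the Frobenius geometry is thus that of the matrix type as
  a real inner product space.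
\<close>

lemma frob_inner_eq_inner: "frob_inner A B = A \<bullet> B" if "A \<in> herm"
  for A B :: "complex ^ 'n::finite ^ 'n"
proof -
  have "frob_inner A B = (\<Sum>i\<in>UNIV. \<Sum>k\<in>UNIV. Re (cnj (A $ k $ i) * B $ k $ i))"
    by (simp add: frob_inner_def trace_def matrix_matrix_mult_def herm_component[OF that])
  also have "\<dots> = (\<Sum>k\<in>UNIV. \<Sum>i\<in>UNIV. Re (cnj (A $ k $ i) * B $ k $ i))"
    by (rule sum.swap)
  finally show ?thesis
    by (simp add: inner_vec_def inner_complex_def)
qed

lemma frob_norm_eq_norm: "frob_norm A = norm A" if "A \<in> herm"
  for A :: "complex ^ 'n::finite ^ 'n"
  by (simp add: frob_norm_def frob_inner_eq_inner[OF that] norm_eq_sqrt_inner)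

text \<open>
  By cyclicity of the trace, \<open>Y \<mapsto> X ** Y ** X\<close> is self-adjoint.
\<close>

lemma inner_sandwich: "(X ** B ** X) \<bullet> A = B \<bullet> (X ** A ** X)"
  if "X \<in> herm" "A \<in> herm" "B \<in> herm"
  for X A B :: "complex ^ 'n::finite ^ 'n"
proof -
  have "trace (X ** B ** X ** A) = trace (B ** X ** A ** X)"
    using trace_mul_sym[of X "B ** X ** A"] by (simp add: matrix_mul_assoc)
  then show ?thesis
    using that by (simp flip: frob_inner_eq_inner add: herm_sandwich frob_inner_def matrix_mul_assoc)
qed

lemma inner_rank_one: "rank_one u \<bullet> B = u \<bullet> (B *v u)"
  for B :: "complex ^ 'n::finite ^ 'n"
proof -
  have "rank_one u \<bullet> B = Re (\<Sum>k\<in>UNIV. cnj (u $ k) * (\<Sum>l\<in>UNIV. B $ k $ l * u $ l))"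
    by (simp add: inner_vec_def rank_one_def inner_complex_def sum_distrib_left algebra_simps)
  also have "\<dots> = u \<bullet> (B *v u)"
    by (simp add: Re_cinner[symmetric] cinner_def matrix_vector_mult_def)
  finally show ?thesis .
qed

lemma matrix_mult_rank_one: "X ** rank_one u ** conj_transpose X = rank_one (X *v u)"
  for X :: "complex ^ 'n::finite ^ 'm::finite"
  unfolding rank_one_def conj_transpose_def matrix_matrix_mult_def matrix_vector_mult_def
  by (simp add: vec_eq_iff sum_distrib_left sum_distrib_right mult_ac)

lemma rank_one_scaleR: "rank_one (c *\<^sub>R u) = c\<^sup>2 *\<^sub>R rank_one u"
  by (simp add: rank_one_def vec_eq_iff power2_eq_square)

lemma matrix_mult_column: "X *v column j Y = column j (X ** Y)"
  by (simp add: vec_eq_iff column_def matrix_vector_mult_def matrix_matrix_mult_def)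

text \<open>
  Together with \<open>inner_rank_one\<close> this turns the vanishing of a diagonal entry of \<open>X ** A ** X\<close> into
  orthogonality to \<open>x\<^sub>j x\<^sub>j\<^sup>*\<close> for Hermitian \<open>A\<close>.
\<close>

lemma sandwich_diag:
  "(X ** A ** X) $ j $ j = cinner (column j X) (A *v column j X)" if "X \<in> herm"
  for X A :: "complex ^ 'n::finite ^ 'n"
proof -
  have "(X ** A ** X) $ j $ j = (\<Sum>k\<in>UNIV. X $ j $ k * (A ** X) $ k $ j)"
    unfolding matrix_mul_assoc[symmetric] by (subst matrix_matrix_mult_def) simp
  also have "\<dots> = cinner (column j X) (A *v column j X)"
    by (simp add: matrix_mult_column cinner_def) (simp add: column_def herm_component[OF that])
  finally show ?thesis .
qed

lemma scale_mat_of_real: "scale_mat (of_real c) A = c *\<^sub>R A"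
  by (simp add: scale_mat_def vec_eq_iff scaleR_conv_of_real[symmetric])

section \<open>Perturbations in the elliptope\<close>

lemma psd_iff: "psd A \<longleftrightarrow> A \<in> herm \<and> (\<forall>z. 0 \<le> z \<bullet> (A *v z))"
  for A :: "complex ^ 'n::finite ^ 'n"
  by (simp add: psd_def Re_cinner)

text \<open>
  Moving from \<open>z\<close> by \<open>- s *\<^sub>R w\<close> with \<open>w = C *v z\<close> changes the quadratic form by
  \<open>- 2 s |w|\<^sup>2\<close> to first order in \<open>s\<close>, so it would become negative unless \<open>w = 0\<close>.
\<close>

lemma psd_kernel:
  fixes C :: "complex ^ 'n::finite ^ 'n"
  assumes "psd C" and z: "z \<bullet> (C *v z) = 0"
  shows "C *v z = 0"
proof -
  define w n m where "w = C *v z" and "n = w \<bullet> w" and "m = w \<bullet> (C *v w)"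
  have C: "C \<in> herm" and nonneg: "\<And>y. 0 \<le> y \<bullet> (C *v y)"
    using assms(1) by (auto simp: psd_iff)
  have m: "m \<ge> 0" and "n \<ge> 0"
    using nonneg by (auto simp: m_def n_def)
  have "(z - s *\<^sub>R w) \<bullet> (C *v (z - s *\<^sub>R w)) = s\<^sup>2 * m - 2 * s * n" for s
    using z inner_herm_adjoint[OF C, of z w]
    by (simp add: matrix_vector_mult_diff_distrib matrix_vector_mult_scaleR_right inner_diff_left
        inner_diff_right w_def[symmetric] n_def m_def power2_eq_square)
      (simp add: inner_commute w_def algebra_simps)
  \<comment> \<open>The minimiser would be \<open>s = n / m\<close>; adding 1 avoids a case distinction on \<open>m = 0\<close>.\<close>
  moreover define q where "q = n / (m + 1)"
  ultimately have "0 \<le> q\<^sup>2 * m - 2 * q * n"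
    by (metis nonneg)
  moreover have n: "n = q * (m + 1)"
    using m by (simp add: q_def)
  ultimately have "q\<^sup>2 * (m + 2) \<le> 0"
    by (simp add: power2_eq_square algebra_simps)
  then have "q\<^sup>2 = 0"
    using m by (smt (verit) mult_pos_pos zero_le_power2)
  then have "n = 0"
    by (simp add: n)
  then show ?thesis
    by (simp add: n_def w_def)
qed

text \<open>
  The condition \<open>X ** B ** X = c\<^sup>2 *\<^sub>R B\<close> says that the Hermitian matrix \<open>B\<close> lives on the range of the
  projection \<open>X / c\<close>, equivalently vanishes on the kernel of \<open>X\<close>. A perturbation does, because
  on that kernel \<open>X\<close> cannot compensate a negative value of \<open>\<plusminus> B\<close>. Conversely, on its
  range \<open>X\<close> acts as the positive scalar \<open>c\<close> and so absorbs a small multiple of \<open>\<plusminus> B\<close>.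
\<close>

lemma pert_elliptope_eq:
  fixes X :: "complex ^ 'n::finite ^ 'n"
  assumes X: "X \<in> herm" and diag: "\<And>i. X $ i $ i = 1"
    and sq: "X ** X = c *\<^sub>R X" and c: "c > 0"
  shows "pert herm elliptope X = {B \<in> herm. X ** B ** X = c\<^sup>2 *\<^sub>R B \<and> (\<forall>i. B $ i $ i = 0)}"
proof (intro equalityI subsetI)
  fix B assume "B \<in> pert herm elliptope X"
  then obtain t where B: "B \<in> herm" and t: "t > 0"
    and p: "X + t *\<^sub>R B \<in> elliptope" and m: "X - t *\<^sub>R B \<in> elliptope"
    by (auto simp: pert_def)
  have "B $ i $ i = 0" for i
    using p t diag[of i] by (simp add: elliptope_def) (metis add_cancel_left_right scaleR_eq_0_iff less_irrefl)
  moreover have ker: "B *v z = 0" if z: "X *v z = 0" for z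
  proof -
    have exp: "(X + t *\<^sub>R B) *v z = t *\<^sub>R (B *v z)" "(X - t *\<^sub>R B) *v z = - (t *\<^sub>R (B *v z))"
      using z by (simp_all add: matrix_vector_mult_add_rdistrib matrix_vector_mult_diff_rdistrib
        matrix_vector_mult_scaleR_left)
    have "psd (X + t *\<^sub>R B)" "psd (X - t *\<^sub>R B)"
      using p m by (auto simp: elliptope_def)
    then have "0 \<le> z \<bullet> (t *\<^sub>R (B *v z))" "0 \<le> z \<bullet> (- (t *\<^sub>R (B *v z)))"
      unfolding psd_iff by (metis exp)+
    then have "z \<bullet> ((X + t *\<^sub>R B) *v z) = 0"
      by (simp add: exp)
    then have "(X + t *\<^sub>R B) *v z = 0"
      using \<open>psd (X + t *\<^sub>R B)\<close> psd_kernel by blast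
    with t show ?thesis by (simp add: exp)
  qed
  have "B ** X = c *\<^sub>R B"
  proof -
    \<comment> \<open>\<open>c *\<^sub>R z - X *v z\<close> is \<open>c\<close> times the component of \<open>z\<close> in the kernel of \<open>X\<close>.\<close>
    have "B *v (c *\<^sub>R z - X *v z) = 0" for z
    proof (rule ker)
      have "X *v (X *v z) = c *\<^sub>R (X *v z)"
        by (simp add: matrix_vector_mul_assoc sq matrix_vector_mult_scaleR_left)
      then show "X *v (c *\<^sub>R z - X *v z) = 0"
        by (simp add: matrix_vector_mult_diff_distrib matrix_vector_mult_scaleR_right)
    qed
    then have "(B ** X) *v z = (c *\<^sub>R B) *v z" for z
      by (simp add: matrix_vector_mult_diff_distrib matrix_vector_mult_scaleR_right
          matrix_vector_mul_assoc[symmetric] matrix_vector_mult_scaleR_left)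
    then show ?thesis by (simp add: matrix_eq)
  qed
  moreover from this have "X ** B = c *\<^sub>R B"
    using conj_transpose_mult[of B X] X B herm_scaleR[OF B, of c] by (simp add: hermD)
  ultimately show "B \<in> {B \<in> herm. X ** B ** X = c\<^sup>2 *\<^sub>R B \<and> (\<forall>i. B $ i $ i = 0)}"
    using B by (simp add: power2_eq_square scalar_matrix_assoc[symmetric])
next
  fix B assume "B \<in> {B \<in> herm. X ** B ** X = c\<^sup>2 *\<^sub>R B \<and> (\<forall>i. B $ i $ i = 0)}"
  then have B: "B \<in> herm" and XBX: "X ** B ** X = c\<^sup>2 *\<^sub>R B" and B0: "\<And>i. B $ i $ i = 0"
    by auto
  obtain K where K: "K > 0" "\<And>z. norm (B *v z) \<le> K * norm z"
    using norm_matrix_vector_mult_le[of B] by blast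
  \<comment> \<open>This \<open>t\<close> makes \<open>t K \<le> c\<close>, and \<open>c\<close> is the value of \<open>X\<close> on its range.\<close>
  define t where "t = c / K"
  have t: "t > 0" using K c by (simp add: t_def)
  have bound: "\<bar>t * (z \<bullet> (B *v z))\<bar> \<le> z \<bullet> (X *v z)" for z
  proof -
    let ?w = "X *v z"
    have "(c\<^sup>2 *\<^sub>R B) *v z = X *v (B *v ?w)"
      by (simp flip: XBX add: matrix_vector_mul_assoc matrix_mul_assoc)
    then have "c\<^sup>2 *\<^sub>R (B *v z) = X *v (B *v ?w)"
      by (simp add: matrix_vector_mult_scaleR_left)
    then have "c\<^sup>2 * (z \<bullet> (B *v z)) = ?w \<bullet> (B *v ?w)"
      by (metis inner_herm_adjoint[OF X] inner_scaleR_right)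
    moreover have "\<bar>?w \<bullet> (B *v ?w)\<bar> \<le> K * (norm ?w)\<^sup>2"
      using Cauchy_Schwarz_ineq2[of ?w "B *v ?w"] mult_left_mono[OF K(2)[of ?w] norm_ge_zero[of ?w]]
      by (simp add: power2_eq_square mult_ac)
    ultimately have "c\<^sup>2 * \<bar>z \<bullet> (B *v z)\<bar> \<le> K * (norm ?w)\<^sup>2"
      by (metis abs_mult abs_power2)
    moreover have "(norm ?w)\<^sup>2 = c * (z \<bullet> ?w)"
    proof -
      have "X *v ?w = c *\<^sub>R ?w"
        by (simp add: matrix_vector_mul_assoc sq matrix_vector_mult_scaleR_left)
      then show ?thesis
        by (metis inner_herm_adjoint[OF X] inner_scaleR_right power2_norm_eq_inner)
    qed
    ultimately have "c * \<bar>z \<bullet> (B *v z)\<bar> \<le> K * (z \<bullet> ?w)"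
      using c by (simp add: power2_eq_square mult_ac)
    then show ?thesis
      using K(1) c by (simp add: t_def abs_mult field_simps)
  qed
  have "psd (X + t *\<^sub>R B)" "psd (X - t *\<^sub>R B)"
    using bound unfolding psd_iff
    by (auto simp: herm_add herm_diff herm_scaleR X B matrix_vector_mult_add_rdistrib
        matrix_vector_mult_diff_rdistrib inner_add_right inner_diff_right matrix_vector_mult_scaleR_left abs_le_iff)
      (smt (verit))+
  then show "B \<in> pert herm elliptope X"
    using t B B0 diag by (auto simp: pert_def elliptope_def psd_iff)
qed

section \<open>Orthogonal projection in the Frobenius norm\<close>

text \<open>
  By Pythagoras, \<open>|A - B|\<^sup>2 = |A - F|\<^sup>2 + |F - B|\<^sup>2\<close> on \<open>S\<close>. So \<open>F\<close> is a minimiser and the only one,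
  and uniqueness makes the choice in \<open>arg_min_on\<close> return it.
\<close>

lemma frob_proj_eqI:
  fixes A F :: "complex ^ 'n::finite ^ 'n"
  assumes S: "S \<subseteq> herm" and A: "A \<in> herm" and F: "F \<in> S"
    and orth: "\<And>B. B \<in> S \<Longrightarrow> (A - F) \<bullet> (F - B) = 0"
  shows "frob_proj S A = F"
proof -
  let ?f = "\<lambda>B. 1 / 2 * (frob_norm (A - B))\<^sup>2"
  have pyth: "?f B = ?f F + 1 / 2 * (norm (F - B))\<^sup>2" if B: "B \<in> S" for B
  proof -
    have "A - B \<in> herm" "A - F \<in> herm"
      using S A F B by (auto intro: herm_diff)
    moreover have "(norm ((A - F) + (F - B)))\<^sup>2 = (norm (A - F))\<^sup>2 + (norm (F - B))\<^sup>2"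
      using orth[OF B] by (intro norm_add_Pythagorean) (simp add: orthogonal_def)
    ultimately show ?thesis
      by (simp add: frob_norm_eq_norm)
  qed
  have "is_arg_min ?f (\<lambda>B. B \<in> S) F"
    unfolding is_arg_min_linorder
  proof (intro conjI allI impI)
    show "?f F \<le> ?f B" if "B \<in> S" for B
      unfolding pyth[OF that] by simp
  qed (rule F)
  moreover have "B = F" if B: "is_arg_min ?f (\<lambda>B. B \<in> S) B" for B
  proof -
    have BS: "B \<in> S" and le: "?f B \<le> ?f F"
      using B F by (auto simp: is_arg_min_linorder)
    have "(norm (F - B))\<^sup>2 \<le> 0"
      using le unfolding pyth[OF BS] by linarith
    then show ?thesis
      by simp
  qed
  ultimately show ?thesis
    unfolding frob_proj_def arg_min_on_def arg_min_def by (blast intro: some_equality)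
qed

section \<open>Linear independence and Gram matrices\<close>

lemma indep_family_iff:
  fixes f :: "'i::finite \<Rightarrow> 'a::real_vector"
  shows "indep_family f \<longleftrightarrow> (\<forall>c. (\<Sum>i\<in>UNIV. c i *\<^sub>R f i) = 0 \<longrightarrow> (\<forall>i. c i = 0))"
    (is "_ \<longleftrightarrow> ?R")
proof
  assume indep: "indep_family f"
  then have inj: "inj f" and ind: "independent (range f)"
    by (auto simp: indep_family_def)
  show ?R
  proof (intro allI impI)
    fix c :: "'i \<Rightarrow> real" and i
    assume c: "(\<Sum>i\<in>UNIV. c i *\<^sub>R f i) = 0"
    have "(\<Sum>x\<in>range f. c (inv f x) *\<^sub>R x) = 0"
      using c inj by (simp add: sum.reindex)
    then have "\<forall>x\<in>range f. c (inv f x) = 0"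
      using ind dependent_finite[of "range f"] by (auto intro: ccontr)
    then show "c i = 0"
      using inj by auto
  qed
next
  assume R: ?R
  have inj: "inj f"
  proof (rule injI, rule ccontr)
    fix i j assume f: "f i = f j" and ne: "i \<noteq> j"
    \<comment> \<open>A repeated member gives the nontrivial relation \<open>f i - f j = 0\<close>.\<close>
    let ?c = "\<lambda>k. (if k = i then 1 else 0) - (if k = j then 1 else 0) :: real"
    have "(\<Sum>k\<in>UNIV. ?c k *\<^sub>R f k) = 0"
      using f by (simp add: scaleR_diff_left sum_subtractf if_distrib[of "\<lambda>a. a *\<^sub>R _"] cong: if_cong)
    then have "?c i = 0" using R[rule_format, of ?c i] by blast
    then show False using ne by simp
  qed
  moreover have "independent (range f)"
  proof
    assume "dependent (range f)"
    then obtain u where u: "(\<Sum>x\<in>range f. u x *\<^sub>R x) = 0" "\<exists>x\<in>range f. u x \<noteq> 0"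
      using dependent_finite[of "range f"] by auto
    then have "(\<Sum>i\<in>UNIV. u (f i) *\<^sub>R f i) = 0"
      using inj by (simp add: sum.reindex)
    with R[rule_format, of "\<lambda>i. u (f i)"] u(2) show False by auto
  qed
  ultimately show "indep_family f" by (simp add: indep_family_def)
qed

text \<open>
  The Gram matrix \<open>M\<close> satisfies \<open>x \<bullet> (M *v x) = |\<Sum>j. x\<^sub>j f\<^sub>j|\<^sup>2\<close>, so its kernel consists exactly of the
  coefficient vectors of linear relations among the \<open>f\<^sub>j\<close>.
\<close>

lemma indep_family_iff_invertible_gram:
  fixes f :: "'i::finite \<Rightarrow> 'a::real_inner"
  shows "indep_family f \<longleftrightarrow> invertible ((\<chi> i j. f i \<bullet> f j) :: real ^ 'i ^ 'i)"
    (is "_ \<longleftrightarrow> invertible ?M")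
proof -
  have M: "(?M *v x) $ i = f i \<bullet> (\<Sum>j\<in>UNIV. (x $ j) *\<^sub>R f j)" for x i
    by (simp add: matrix_vector_mult_def inner_sum_right mult.commute)
  have ker: "?M *v x = 0 \<longleftrightarrow> (\<Sum>j\<in>UNIV. (x $ j) *\<^sub>R f j) = 0" for x
  proof
    let ?s = "\<Sum>j\<in>UNIV. (x $ j) *\<^sub>R f j"
    assume "?M *v x = 0"
    then have "f i \<bullet> ?s = 0" for i
      unfolding M[symmetric] by simp
    then have "?s \<bullet> ?s = 0"
      by (subst inner_sum_left) simp
    then show "?s = 0" by simp
  qed (simp add: vec_eq_iff M)
  have "indep_family f \<longleftrightarrow> (\<forall>x. ?M *v x = 0 \<longrightarrow> x = 0)"
    unfolding ker indep_family_iff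
  proof safe
    fix c :: "'i \<Rightarrow> real" and i
    assume "\<forall>x :: real ^ 'i. (\<Sum>j\<in>UNIV. (x $ j) *\<^sub>R f j) = 0 \<longrightarrow> x = 0"
      and "(\<Sum>j\<in>UNIV. c j *\<^sub>R f j) = 0"
    then have "(\<chi> j. c j) = (0 :: real ^ 'i)"
      by simp
    then show "c i = 0"
      by (simp add: vec_eq_iff)
  qed (simp add: vec_eq_iff)
  then show ?thesis
    by (simp add: invertible_left_inverse matrix_left_invertible_ker)
qed

section \<open>The Gram matrix of a unit norm tight frame\<close>

lemma gram_herm: "gram v \<in> herm"
  by (simp add: herm_def conj_transpose_def gram_def vec_eq_iff cnj_cinner)

lemma cinner_self: "cinner u u = of_real ((norm u)\<^sup>2)"
  for u :: "complex ^ 'm::finite"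
proof -
  have "mat 1 \<in> herm"
    by (auto simp: herm_def conj_transpose_def mat_def vec_eq_iff)
  from cinner_herm_real[OF this, of u] show ?thesis
    by (simp add: power2_norm_eq_inner)
qed

lemma untf_gram_diag: "gram v $ i $ i = 1" if "untf v"
  for v :: "'n::finite \<Rightarrow> complex ^ 'r::finite"
  using that by (simp add: gram_def cinner_self untf_def)

text \<open>
  With \<open>V\<close> the matrix whose columns are the frame vectors, \<open>X = V\<^sup>* V\<close> and tightness says
  \<open>V V\<^sup>* = c I\<close>; hence \<open>X X = V\<^sup>* (V V\<^sup>*) V = c X\<close>.
\<close>

lemma untf_gram_square:
  fixes v :: "'n::finite \<Rightarrow> complex ^ 'r::finite"
  assumes "untf v"
  shows "gram v ** gram v = (real CARD('n) / real CARD('r)) *\<^sub>R gram v"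
proof -
  let ?c = "real CARD('n) / real CARD('r)"
  have frame: "(\<Sum>k\<in>UNIV. v k $ a * cnj (v k $ b)) = (if a = b then of_real ?c else 0)" for a b
  proof -
    have "(\<Sum>k\<in>UNIV. rank_one (v k)) $ a $ b = (?c *\<^sub>R mat 1) $ a $ b"
      using assms by (simp only: untf_def)
    then show ?thesis
      by (simp add: rank_one_def mat_def) (simp add: scaleR_conv_of_real)
  qed
  have "(gram v ** gram v) $ i $ j = (?c *\<^sub>R gram v) $ i $ j" for i j
  proof -
    have "(gram v ** gram v) $ i $ j
        = (\<Sum>k\<in>UNIV. \<Sum>a\<in>UNIV. \<Sum>b\<in>UNIV. cnj (v i $ a) * v j $ b * (v k $ a * cnj (v k $ b)))"
      by (simp add: gram_def matrix_matrix_mult_def cinner_def sum_product)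
        (simp add: mult_ac)
    also have "\<dots> = (\<Sum>a\<in>UNIV. \<Sum>k\<in>UNIV. \<Sum>b\<in>UNIV. cnj (v i $ a) * v j $ b * (v k $ a * cnj (v k $ b)))"
      by (rule sum.swap)
    also have "\<dots> = (\<Sum>a\<in>UNIV. \<Sum>b\<in>UNIV. \<Sum>k\<in>UNIV. cnj (v i $ a) * v j $ b * (v k $ a * cnj (v k $ b)))"
      by (intro sum.cong refl sum.swap)
    also have "\<dots> = (\<Sum>a\<in>UNIV. \<Sum>b\<in>UNIV. cnj (v i $ a) * v j $ b * (if a = b then of_real ?c else 0))"
      by (simp only: sum_distrib_left[symmetric] frame)
    also have "\<dots> = (\<Sum>a\<in>UNIV. cnj (v i $ a) * v j $ a * of_real ?c)"
      by (simp add: if_distrib cong: if_cong)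
    also have "\<dots> = (?c *\<^sub>R gram v) $ i $ j"
      by (simp add: gram_def cinner_def) (simp add: scaleR_conv_of_real sum_distrib_left mult_ac)
    finally show ?thesis .
  qed
  then show ?thesis by (simp add: vec_eq_iff)
qed

lemma inner_rank_one_rank_one: "rank_one u \<bullet> rank_one w = (cmod (cinner u w))\<^sup>2"
  for u w :: "complex ^ 'n::finite"
proof -
  have "rank_one w *v u = (\<chi> k. w $ k * cinner w u)"
    by (simp add: rank_one_def matrix_vector_mult_def cinner_def vec_eq_iff sum_distrib_left mult.assoc)
  then have "cinner u (rank_one w *v u) = (\<Sum>k\<in>UNIV. cnj (u $ k) * (w $ k * cinner w u))"
    by (simp add: cinner_def[of u])
  also have "\<dots> = cinner u w * cinner w u"
    by (simp only: cinner_def[of u] sum_distrib_right mult.assoc)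
  also have "\<dots> = cinner u w * cnj (cinner u w)"
    by (simp add: cnj_cinner)
  also have "\<dots> = of_real ((cmod (cinner u w))\<^sup>2)"
    by (rule complex_norm_square[symmetric])
  finally show ?thesis
    unfolding inner_rank_one Re_cinner[symmetric] by simp
qed

text \<open>
  The entrywise square of the Gram matrix of the \<open>v\<^sub>i\<close> is the Gram matrix of the \<open>v\<^sub>i v\<^sub>i\<^sup>*\<close>, to which
  the criterion for linear independence applies.
\<close>

lemma abs_sq_mat_gram:
  "abs_sq_mat (gram v) = (\<chi> i j. rank_one (v i) \<bullet> rank_one (v j))"
  for v :: "'n::finite \<Rightarrow> complex ^ 'r::finite"
  by (simp add: abs_sq_mat_def gram_def inner_rank_one_rank_one)

section \<open>The projection formula\<close>

text \<open>
  Call the right-hand side \<open>F\<close>. It lies in the perturbation space: the columns of \<open>X\<close> are fixed by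
  the projection \<open>X / c\<close>, and the inverse of the entrywise square of \<open>X\<close> is what makes the
  diagonal vanish. The difference \<open>A - F\<close> is orthogonal to each \<open>B\<close> in that space: \<open>A\<close> and
  \<open>X ** A ** X / c\<^sup>2\<close> have the same inner product with \<open>B\<close>, and the inner product of \<open>x\<^sub>j x\<^sub>j\<^sup>*\<close> with \<open>B\<close> is
  the diagonal entry of \<open>X ** B ** X = c\<^sup>2 *\<^sub>R B\<close>, which is zero.
\<close>

lemma frob_proj_pert_elliptope:
  fixes X :: "complex ^ 'n::finite ^ 'n"
  assumes X: "X \<in> herm" and diag: "\<And>i. X $ i $ i = 1"
    and sq: "X ** X = c *\<^sub>R X" and c: "c > 0"
    and inv: "invertible (abs_sq_mat X)" and A: "A \<in> herm"
  shows "frob_proj (pert herm elliptope X) A = (1 / c\<^sup>2) *\<^sub>R (X ** A ** X -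
            (\<Sum>i\<in>UNIV. \<Sum>j\<in>UNIV.
              scale_mat (of_real (matrix_inv (abs_sq_mat X) $ i $ j)
                  * cinner (column i X) (A *v column i X))
                (rank_one (column j X))))"
proof -
  define M a b R F where "M = matrix_inv (abs_sq_mat X)"
    and "a = (\<lambda>i. column i X \<bullet> (A *v column i X))"
    and "b = (\<lambda>j. \<Sum>i\<in>UNIV. M $ i $ j * a i)"
    and "R = (\<Sum>j\<in>UNIV. b j *\<^sub>R rank_one (column j X))"
    and "F = (1 / c\<^sup>2) *\<^sub>R (X ** A ** X - R)"
  \<comment> \<open>The values \<open>x\<^sub>i\<^sup>* A x\<^sub>i\<close> are real, so the complex combination is a real one.\<close>
  have "(\<Sum>i\<in>UNIV. \<Sum>j\<in>UNIV. scale_mat (of_real (M $ i $ j) * cinner (column i X) (A *v column i X))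
                (rank_one (column j X))) =
        (\<Sum>i\<in>UNIV. \<Sum>j\<in>UNIV. (M $ i $ j * a i) *\<^sub>R rank_one (column j X))"
    by (simp only: cinner_herm_real[OF A] of_real_mult[symmetric] scale_mat_of_real a_def)
  also have "\<dots> = R"
    unfolding R_def b_def by (subst sum.swap) (simp add: scaleR_sum_left)
  finally have goal_eq: "(1 / c\<^sup>2) *\<^sub>R (X ** A ** X -
            (\<Sum>i\<in>UNIV. \<Sum>j\<in>UNIV.
              scale_mat (of_real (matrix_inv (abs_sq_mat X) $ i $ j)
                  * cinner (column i X) (A *v column i X))
                (rank_one (column j X)))) = F"
    by (simp add: F_def M_def)

  have col: "X ** rank_one (column j X) ** X = c\<^sup>2 *\<^sub>R rank_one (column j X)" for j
  proof -
    have "X *v column j X = c *\<^sub>R column j X"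
      by (simp add: matrix_mult_column sq) (simp add: column_def vec_eq_iff)
    then show ?thesis
      using matrix_mult_rank_one[of X "column j X"] by (simp add: hermD[OF X] rank_one_scaleR)
  qed
  note lin = linear_sandwich[of X]
  have XRX: "X ** R ** X = c\<^sup>2 *\<^sub>R R"
    unfolding R_def linear_sum[OF lin] by (simp add: linear_scale[OF lin] col scaleR_sum_right mult.commute)
  have XAX: "X ** (X ** A ** X) ** X = c\<^sup>2 *\<^sub>R (X ** A ** X)"
  proof -
    have "X ** (X ** A ** X) ** X = (X ** X) ** A ** (X ** X)"
      by (simp add: matrix_mul_assoc)
    then show ?thesis
      by (simp add: sq power2_eq_square matrix_scalar_ac scalar_matrix_assoc[symmetric])
  qed
  have FX: "X ** F ** X = c\<^sup>2 *\<^sub>R F"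
    unfolding F_def linear_scale[OF lin] linear_diff[OF lin] XRX XAX
    by (simp add: scaleR_diff_right)
  have R: "R \<in> herm"
    unfolding R_def by (intro herm_sum herm_scaleR herm_rank_one)
  then have F: "F \<in> herm"
    unfolding F_def by (intro herm_scaleR herm_diff herm_sandwich X A)
  have Fdiag: "F $ k $ k = 0" for k
  proof -
    have "R $ k $ k = of_real (\<Sum>j\<in>UNIV. b j * abs_sq_mat X $ j $ k)"
    proof -
      have "rank_one (column j X) $ k $ k = of_real (abs_sq_mat X $ j $ k)" for j
      proof -
        have "rank_one (column j X) $ k $ k = X $ k $ j * cnj (X $ k $ j)"
          by (simp add: rank_one_def column_def)
        also have "\<dots> = of_real ((cmod (X $ k $ j))\<^sup>2)"
          by (rule complex_norm_square[symmetric])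
        also have "cmod (X $ k $ j) = cmod (X $ j $ k)"
          by (metis X complex_mod_cnj herm_component)
        finally show ?thesis by (simp add: abs_sq_mat_def)
      qed
      then show ?thesis by (simp add: R_def) (simp add: scaleR_conv_of_real)
    qed
    also have "(\<Sum>j\<in>UNIV. b j * abs_sq_mat X $ j $ k) = (\<Sum>i\<in>UNIV. a i * (M ** abs_sq_mat X) $ i $ k)"
      unfolding b_def sum_distrib_right
      by (subst sum.swap) (simp add: matrix_matrix_mult_def sum_distrib_left mult_ac)
    also have "\<dots> = a k"
    proof -
      have "M ** abs_sq_mat X = mat 1"
        using someI_ex[OF inv[unfolded invertible_def]] by (simp add: M_def matrix_inv_def)
      then show ?thesis by (simp add: mat_def if_distrib cong: if_cong)
    qed
    also have "of_real (a k) = (X ** A ** X) $ k $ k"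
      by (simp add: sandwich_diag[OF X] cinner_herm_real[OF A] a_def)
    finally show ?thesis by (simp add: F_def)
  qed
  have pert: "pert herm elliptope X = {B \<in> herm. X ** B ** X = c\<^sup>2 *\<^sub>R B \<and> (\<forall>i. B $ i $ i = 0)}"
    by (rule pert_elliptope_eq[OF X diag sq c])
  have orth: "(A - F) \<bullet> B = 0" if B: "B \<in> herm" "X ** B ** X = c\<^sup>2 *\<^sub>R B" "\<And>i. B $ i $ i = 0" for B
  proof -
    have "R \<bullet> B = (\<Sum>j\<in>UNIV. b j * (column j X \<bullet> (B *v column j X)))"
      by (simp add: R_def inner_sum_left inner_rank_one)
    also have "\<dots> = 0"
      using sandwich_diag[OF X, of B] by (simp add: B Re_cinner[symmetric])
    finally have "R \<bullet> B = 0" .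
    moreover have "(X ** A ** X) \<bullet> B = c\<^sup>2 * (A \<bullet> B)"
      using inner_sandwich[OF X B(1) A] by (simp add: B)
    ultimately show ?thesis
      using c by (simp add: F_def inner_diff_left)
  qed
  have "frob_proj (pert herm elliptope X) A = F"
  proof (rule frob_proj_eqI)
    show "F \<in> pert herm elliptope X" using F FX Fdiag by (simp add: pert)
    show "(A - F) \<bullet> (F - B) = 0" if "B \<in> pert herm elliptope X" for B
      using that F FX Fdiag orth[of F] orth[of B] by (simp add: pert inner_diff_right)
  qed (auto simp: pert A)
  then show ?thesis by (simp add: goal_eq)
qed

theorem lemma2p2:
  fixes v :: "'n::finite \<Rightarrow> complex ^ 'r::finite"
    and X :: "complex ^ 'n ^ 'n"
  assumes "untf v"
    and "X = gram v"
  shows "(indep_family (\<lambda>i. rank_one (v i)) \<longleftrightarrow> invertible (abs_sq_mat X)) \<and>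
    (indep_family (\<lambda>i. rank_one (v i)) \<longrightarrow>
      (\<forall>A\<in>herm. frob_proj (pert herm elliptope X) A =
        ((real CARD('r))\<^sup>2 / (real CARD('n))\<^sup>2) *\<^sub>R
          (X ** A ** X -
            (\<Sum>i\<in>UNIV. \<Sum>j\<in>UNIV.
              scale_mat (of_real (matrix_inv (abs_sq_mat X) $ i $ j)
                  * cinner (column i X) (A *v column i X))
                (rank_one (column j X))))))"
proof -
  let ?c = "real CARD('n) / real CARD('r)"
  have iff: "indep_family (\<lambda>i. rank_one (v i)) \<longleftrightarrow> invertible (abs_sq_mat X)"
    unfolding assms(2) abs_sq_mat_gram by (rule indep_family_iff_invertible_gram)
  have c: "?c > 0" by simp
  have scale: "1 / ?c\<^sup>2 = (real CARD('r))\<^sup>2 / (real CARD('n))\<^sup>2"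
    by (simp add: power_divide)
  note formula = frob_proj_pert_elliptope[OF gram_herm untf_gram_diag[OF assms(1)]
      untf_gram_square[OF assms(1)] c, folded assms(2), unfolded scale]
  show ?thesis
    unfolding iff by (intro conjI impI ballI refl formula)
qed

end
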